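(* Let $\beta > 0$ and $w_0 \in \mathbb{R}$. Then there exists a unique function $u \in C^1([0,\infty))$ (real-valued) satisfying $$\frac{du}{dt}(t) = w_0\,|1 - u(t-1)|^\beta \quad \text{for all } t > 1, \qquad u(t) = w_0 t \quad \text{for all } 0 \le t \le 1.$$
   Context: $C^1([0,\infty))$ denotes the real-valued continuously differentiable functions on $[0,\infty)$, with the derivative at $t=0$ understood as the one-sided (right) derivative. *)

theory Defs
  imports Complex_Main "HOL-Library.FuncSet"
begin

text \<open>
  The space of continuously differentiable real functions on the half-line. Derivatives are taken
  within \<open>{0..}\<close>, hence one-sided at \<open>0\<close> and two-sided at every \<open>t > 0\<close>;
  \<open>C1_differentiable_on\<close> of HOL-Analysis would demand a two-sided derivative at \<open>0\<close>.
  Functions on the half-line are represented by total functions that are \<open>undefined\<close> off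
  \<open>{0..}\<close>, so that equality in this set is equality of functions on the half-line.
\<close>

definition C1_halfline :: "(real \<Rightarrow> real) set" where
  "C1_halfline = {u \<in> extensional {0..}.
     \<exists>u'. continuous_on {0..} u' \<and>
          (\<forall>t\<in>{0..}. (u has_real_derivative u' t) (at t within {0..}))}"

end

theory Submission
  imports Defs "HOL-Analysis.Henstock_Kurzweil_Integration"
begin

text \<open>
  The proof is the method of steps. Put \<open>f x = w\<^sub>0 * \<bar>1 - x\<bar> powr \<beta>\<close>. Since \<open>\<beta> > 0\<close>, the function
  \<open>f\<close> is continuous on the whole line, also at the zero \<open>x = 1\<close> of the base, and \<open>f 0 = w\<^sub>0\<close>.
  Hence the prescribed initial segment \<open>w\<^sub>0 * t\<close> is itself what the delay equation
  \<open>u' t = f (u (t - 1))\<close> yields on \<open>[0, 1]\<close> when \<open>u\<close> is continued by \<open>0\<close> to negative times.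
  So the solutions are the functions on the half-line that satisfy
  \<open>u t = integral {0..t} (\<lambda>s. f (u (max 0 (s - 1))))\<close>
  (the truncation at \<open>0\<close> replaces the continuation, because \<open>u 0 = 0\<close>), and their derivative is
  continuous because the integrand is; this includes the junction \<open>t = 1\<close>.

  Because of the delay, the right-hand side up to time \<open>t\<close> involves \<open>u\<close> only up to time \<open>t - 1\<close>.
  Therefore the Picard iterates started at \<open>0\<close> do not merely converge: the \<open>n\<close>-th iterate is already
  final on \<open>[0, n]\<close> (\<open>delay_iterate_stable\<close>), and gluing the iterates gives a solution
  (\<open>delay_solution_fixpoint\<close>). This takes the place of a contraction argument, which would
  break down for \<open>\<beta> < 1\<close>, where \<open>f\<close> has unbounded slope near \<open>1\<close> unless \<open>w\<^sub>0 = 0\<close>. Uniqueness follows the same pattern: if two solutions agree up to time \<open>n\<close>,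
  their difference has zero derivative between \<open>1\<close> and \<open>n + 1\<close> (\<open>delay_solution_unique\<close>).
\<close>

definition delay_picard :: "(real \<Rightarrow> real) \<Rightarrow> (real \<Rightarrow> real) \<Rightarrow> real \<Rightarrow> real" where
  "delay_picard f x t = integral {0..t} (\<lambda>s. f (x (max 0 (s - 1))))"

abbreviation delay_iterate :: "(real \<Rightarrow> real) \<Rightarrow> nat \<Rightarrow> real \<Rightarrow> real" where
  "delay_iterate f n \<equiv> (delay_picard f ^^ n) (\<lambda>_. 0)"

text \<open>At time \<open>t\<close> any iterate with index at least \<open>t\<close> would do; rounding up picks one.\<close>

definition delay_solution :: "(real \<Rightarrow> real) \<Rightarrow> real \<Rightarrow> real" where
  "delay_solution f t = delay_iterate f (nat \<lceil>t\<rceil>) t"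

lemma integral_has_real_derivative_halfline:
  fixes g :: "real \<Rightarrow> real"
  assumes "continuous_on {a..} g" "a \<le> t"
  shows "((\<lambda>t. integral {a..t} g) has_real_derivative g t) (at t within {a..})"
proof -
  have "((\<lambda>t. integral {a..t} g) has_real_derivative g t) (at t within {a..t + 1})"
    using assms by (intro integral_has_real_derivative) (auto intro: continuous_on_subset)
  moreover have "at t within {a..t + 1} = at t within {a..}"
    by (rule at_within_nhd[of t "{..<t + 1}"]) auto
  ultimately show ?thesis by simp
qed

lemma continuous_on_delayed:
  fixes f x :: "real \<Rightarrow> real"
  assumes "continuous_on UNIV f" "continuous_on {0..} x"
  shows "continuous_on {0..} (\<lambda>s. f (x (max 0 (s - 1))))"
proof -
  have "continuous_on {0..} (\<lambda>s::real. x (max 0 (s - 1)))"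
    by (rule continuous_on_compose2[OF assms(2)]) (auto intro!: continuous_intros)
  then show ?thesis
    by (rule continuous_on_compose2[OF assms(1)]) auto
qed

lemma delay_picard_has_derivative:
  assumes "continuous_on UNIV f" "continuous_on {0..} x" "0 \<le> t"
  shows "(delay_picard f x has_real_derivative f (x (max 0 (t - 1)))) (at t within {0..})"
  using integral_has_real_derivative_halfline[OF continuous_on_delayed[OF assms(1,2)] assms(3)]
  by (simp add: delay_picard_def[abs_def])

lemma delay_picard_cong:
  assumes "\<And>s. 0 \<le> s \<Longrightarrow> s \<le> max 0 (t - 1) \<Longrightarrow> x s = y s"
  shows "delay_picard f x t = delay_picard f y t"
  unfolding delay_picard_def by (rule integral_cong) (use assms in auto)

lemma continuous_on_delay_iterate:
  assumes "continuous_on UNIV f"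
  shows "continuous_on {0..} (delay_iterate f n)"
proof (induction n)
  case (Suc n)
  have "continuous_on {0..} (delay_picard f (delay_iterate f n))"
    by (rule DERIV_continuous_on, rule delay_picard_has_derivative[OF assms Suc]) simp
  then show ?case by simp
qed auto

text \<open>One application of the integral operator advances the agreement of two functions by one
  unit of time, the delay.\<close>

lemma delay_iterate_Suc_eq:
  assumes "0 \<le> t" "t \<le> real n"
  shows "delay_iterate f (Suc n) t = delay_iterate f n t"
  using assms
proof (induction n arbitrary: t)
  case 0
  then show ?case by (simp add: delay_picard_def)
next
  case (Suc n)
  have "delay_picard f (delay_iterate f (Suc n)) t = delay_picard f (delay_iterate f n) t"
    using Suc by (intro delay_picard_cong) auto
  then show ?case by simp
qed

lemma delay_iterate_stable:
  assumes "0 \<le> t" "t \<le> real n" "n \<le> m"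
  shows "delay_iterate f m t = delay_iterate f n t"
  using assms(3)
proof (induction m rule: dec_induct)
  case (step m)
  have "delay_iterate f (Suc m) t = delay_iterate f m t"
    using assms step by (intro delay_iterate_Suc_eq) auto
  then show ?case using step by simp
qed simp

lemma delay_solution_eq_iterate:
  assumes "0 \<le> t" "t \<le> real n"
  shows "delay_solution f t = delay_iterate f n t"
  unfolding delay_solution_def
  by (rule delay_iterate_stable[symmetric]) (use assms in \<open>linarith+\<close>)

lemma delay_solution_0: "delay_solution f 0 = 0"
  by (simp add: delay_solution_def)

lemma continuous_on_delay_solution:
  assumes "continuous_on UNIV f"
  shows "continuous_on {0..} (delay_solution f)"
  unfolding continuous_on_eq_continuous_within
proof
  fix t :: real assume "t \<in> {0..}"
  then have t: "0 \<le> t" by simp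
  obtain n where n: "t < real n" using reals_Archimedean2 by blast
  have "continuous (at t within {0..}) (delay_iterate f n)"
    using continuous_on_delay_iterate[OF assms] t
    by (auto simp: continuous_on_eq_continuous_within)
  then have *: "continuous (at t within {0..real n}) (delay_iterate f n)"
    by (rule continuous_within_subset) auto
  have "continuous (at t within {0..real n}) (delay_solution f)"
    by (rule continuous_transform_within[OF * zero_less_one])
      (use t n in \<open>auto simp: delay_solution_eq_iterate\<close>)
  \<comment> \<open>The strict bound makes the upper end point invisible near \<open>t\<close>.\<close>
  moreover have "at t within {0..real n} = at t within {0..}"
    by (rule at_within_nhd[of t "{..<real n}"]) (use n in auto)
  ultimately show "continuous (at t within {0..}) (delay_solution f)"
    by simp
qed

lemma delay_solution_fixpoint:
  assumes "0 \<le> t"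
  shows "delay_solution f t = delay_picard f (delay_solution f) t"
proof -
  obtain n where n: "t \<le> real n" using real_arch_simple by blast
  have "delay_solution f t = delay_picard f (delay_iterate f n) t"
    using delay_solution_eq_iterate[of t "Suc n"] assms n by simp
  also have "\<dots> = delay_picard f (delay_solution f) t"
    by (rule delay_picard_cong, rule delay_solution_eq_iterate[symmetric]) (use assms n in auto)
  finally show ?thesis .
qed

lemma delay_solution_has_derivative:
  assumes "continuous_on UNIV f" "0 \<le> t"
  shows "(delay_solution f has_real_derivative f (delay_solution f (max 0 (t - 1))))
           (at t within {0..})"
proof (rule has_field_derivative_transform_within[OF _ zero_less_one])
  show "(delay_picard f (delay_solution f) has_real_derivative
           f (delay_solution f (max 0 (t - 1)))) (at t within {0..})"
    using assms by (intro delay_picard_has_derivative continuous_on_delay_solution)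
qed (use assms in \<open>auto simp: delay_solution_fixpoint[symmetric]\<close>)

lemma delay_solution_initial:
  assumes "t \<in> {0..1}"
  shows "delay_solution f t = f 0 * t"
proof -
  have "delay_solution f t = integral {0..t} (\<lambda>s. f (delay_solution f (max 0 (s - 1))))"
    using assms delay_solution_fixpoint[of t f] by (simp add: delay_picard_def)
  also have "\<dots> = integral {0..t} (\<lambda>s. f 0)"
  proof (rule integral_cong)
    fix s assume "s \<in> {0..t}"
    then have "max 0 (s - 1) = 0" using assms by auto
    then show "f (delay_solution f (max 0 (s - 1))) = f 0"
      by (simp add: delay_solution_0)
  qed
  finally show ?thesis using assms by (simp add: mult.commute)
qed

text \<open>Both right-hand sides look back by one unit of time. So once the solutions agree up to time
  \<open>n\<close>, their derivatives coincide up to time \<open>n + 1\<close>, and the mean value theorem on an interval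
  starting at \<open>1\<close> carries the agreement over.\<close>

lemma delay_solution_unique:
  fixes u v f :: "real \<Rightarrow> real"
  assumes cont: "continuous_on {0..} u" "continuous_on {0..} v"
    and u: "\<And>t. 1 < t \<Longrightarrow> (u has_real_derivative f (u (t - 1))) (at t)"
    and v: "\<And>t. 1 < t \<Longrightarrow> (v has_real_derivative f (v (t - 1))) (at t)"
    and init: "\<And>t. t \<in> {0..1} \<Longrightarrow> u t = v t"
    and t: "0 \<le> t"
  shows "u t = v t"
proof -
  have agree: "u t = v t" if "0 \<le> t" "t \<le> real n" for n t
    using that
  proof (induction n arbitrary: t)
    case 0
    then show ?case using init by auto
  next
    case (Suc n)
    show ?case
    proof (cases "t \<le> 1")
      case True
      then show ?thesis using init Suc.prems by auto
    next
      case False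
      have "u t - v t = u 1 - v 1"
      proof (rule DERIV_isconst_end[of 1 t "\<lambda>s. u s - v s"])
        show "continuous_on {1..t} (\<lambda>s. u s - v s)"
          by (intro continuous_on_diff continuous_on_subset[OF cont(1)]
              continuous_on_subset[OF cont(2)]) auto
        fix s assume s: "1 < s" "s < t"
        have "u (s - 1) = v (s - 1)"
          using s Suc by auto
        then show "((\<lambda>s. u s - v s) has_real_derivative 0) (at s)"
          using DERIV_diff[OF u[OF s(1)] v[OF s(1)]] by simp
      qed (use False in auto)
      then show ?thesis using init[of 1] by simp
    qed
  qed
  obtain n where "t \<le> real n" using real_arch_simple by blast
  with agree t show ?thesis by blast
qed

lemma C1_halfline_continuous_on:
  assumes "u \<in> C1_halfline"
  shows "continuous_on {0..} u"
  using assms unfolding C1_halfline_def by (auto intro: DERIV_continuous_on)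

theorem theorem3p1:
  fixes \<beta> w\<^sub>0 :: real
  assumes "\<beta> > 0"
  shows "\<exists>!u. u \<in> C1_halfline \<and>
           (\<forall>t>1. (u has_real_derivative w\<^sub>0 * \<bar>1 - u (t - 1)\<bar> powr \<beta>) (at t)) \<and>
           (\<forall>t\<in>{0..1}. u t = w\<^sub>0 * t)"
proof -
  define f where "f x = w\<^sub>0 * \<bar>1 - x\<bar> powr \<beta>" for x
  have f: "continuous_on UNIV f"
    unfolding f_def using assms
    by (intro continuous_intros continuous_on_powr') auto
  have f0: "f 0 = w\<^sub>0"
    by (simp add: f_def)
  let ?U = "delay_solution f"
  let ?u = "restrict ?U {0..}"
  let ?P = "\<lambda>u. u \<in> C1_halfline \<and>
           (\<forall>t>1. (u has_real_derivative f (u (t - 1))) (at t)) \<and>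
           (\<forall>t\<in>{0..1}. u t = w\<^sub>0 * t)"
  have deriv: "(?u has_real_derivative f (?U (max 0 (t - 1)))) (at t within {0..})"
    if "0 \<le> t" for t
    by (rule has_field_derivative_transform_within
        [OF delay_solution_has_derivative[OF f that] zero_less_one]) (use that in auto)
  have "?P ?u"
  proof (intro conjI allI impI ballI)
    show "?u \<in> C1_halfline"
      unfolding C1_halfline_def
      using deriv continuous_on_delayed[OF f continuous_on_delay_solution[OF f]] by auto
  next
    fix t :: real assume t: "1 < t"
    have "at t within {0..} = at t"
      using t by (intro at_within_interior) (simp add: interior_Ici[of "-1"])
    then show "(?u has_real_derivative f (?u (t - 1))) (at t)"
      using deriv[of t] t by simp
  next
    fix t :: real assume "t \<in> {0..1}"
    then show "?u t = w\<^sub>0 * t"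
      using delay_solution_initial[of t f] f0 by simp
  qed
  then have "\<exists>u. ?P u"
    by (rule exI[where P = ?P])
  moreover have "u = v" if "?P u" "?P v" for u v
  proof (rule extensionalityI[of _ "{0..}"])
    show "u \<in> extensional {0..}" "v \<in> extensional {0..}"
      using that by (auto simp: C1_halfline_def)
    fix t :: real assume "t \<in> {0..}"
    then show "u t = v t"
      using that by (intro delay_solution_unique[of u v f t] C1_halfline_continuous_on) auto
  qed
  ultimately have "\<exists>!u. ?P u"
    by (rule ex_ex1I)
  then show ?thesis
    by (simp only: f_def)
qed

end
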